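(* Let $S = [A_1, \dots, A_{d+1}]$ ($d\ge 2$) be a non-rectangular orthocentric $d$-simplex, and let $a_1, \dots, a_{d+1}$ be the barycentric coordinates of its orthocenter $H$ with respect to $S$. Let $c = \sigma(S)$ be the obtuseness of $S$. Then no $a_i$ is equal to $0$ or $1$ and, for any real numbers $b_1, \dots, b_{d+1}$, $$\left\| \sum_{i=1}^{d+1} b_i (A_i - H) \right\|^2 = c\left[\left(\sum_{i=1}^{d+1} b_i\right)^2 - \sum_{i=1}^{d+1} \frac{b_i^2}{a_i}\right].$$ In particular, for all $i$ and all $j\neq i$, $$\|A_i - H\|^2 = \frac{c(a_i-1)}{a_i}, \qquad \|A_i - A_j\|^2 = -c\left(\frac{1}{a_i} + \frac{1}{a_j}\right).$$ Also, if $B_i$ is the foot of the perpendicular from the vertex $A_i$ to the $i$-th facet, and if $h_i = \|A_i - B_i\|$ is the corresponding altitude, then $$B_i - H = \frac{a_i}{a_i-1}(A_i - H), \qquad h_i^2 = \frac{c}{a_i(a_i-1)}.$$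
   Context: A $d$-simplex $S=[A_1,\dots,A_{d+1}]$ in Euclidean space $\mathbb{E}^d$ is the convex hull of $d+1$ affinely independent points. The $i$-th facet is the $(d-1)$-face opposite to $A_i$; the foot $B_i$ lies in its affine hull. $S$ is orthocentric if its altitudes (the lines through each vertex perpendicular to the hyperplane of the opposite facet) have a common point, the orthocenter $H$. An orthocentric simplex is rectangular if its orthocenter coincides with one of its vertices. The barycentric coordinates of $H$ with respect to $S$ are the unique reals with $H=\sum a_iA_i$ and $\sum a_i=1$. For an orthocentric $d$-simplex the product $(H-A_i)\cdot(H-A_j)$, $i\ne j$, does not depend on $i,j$; its value $\sigma(S)$ is called the obtuseness of $S$. *)

theory Defs
  imports "HOL-Analysis.Analysis"
begin

text \<open>
  Euclidean \<open>d\<close>-space is a type \<open>'a :: euclidean_space\<close> with \<open>d = DIM('a)\<close>. A simplex is given by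
  its sequence of vertices \<open>A 1, \<dots>, A (d + 1)\<close>; values of \<open>A\<close> at other indices play no role.
\<close>

definition is_simplex :: "(nat \<Rightarrow> 'a::euclidean_space) \<Rightarrow> bool" where
  "is_simplex A \<longleftrightarrow> inj_on A {1..DIM('a) + 1} \<and> \<not> affine_dependent (A ` {1..DIM('a) + 1})"

definition facet_hyperplane :: "(nat \<Rightarrow> 'a::euclidean_space) \<Rightarrow> nat \<Rightarrow> 'a set" where
  "facet_hyperplane A i = affine hull (A ` ({1..DIM('a) + 1} - {i}))"

text \<open>As the facet spans a hyperplane of the whole space, the following set is a line.\<close>

definition altitude_line :: "(nat \<Rightarrow> 'a::euclidean_space) \<Rightarrow> nat \<Rightarrow> 'a set" where
  "altitude_line A i =
     {P. \<forall>x\<in>facet_hyperplane A i. \<forall>y\<in>facet_hyperplane A i. orthogonal (P - A i) (x - y)}"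

definition altitude_foot :: "(nat \<Rightarrow> 'a::euclidean_space) \<Rightarrow> nat \<Rightarrow> 'a" where
  "altitude_foot A i = (THE B. B \<in> facet_hyperplane A i \<and> B \<in> altitude_line A i)"

definition orthocentric :: "(nat \<Rightarrow> 'a::euclidean_space) \<Rightarrow> bool" where
  "orthocentric A \<longleftrightarrow> is_simplex A \<and> (\<exists>H. \<forall>i\<in>{1..DIM('a) + 1}. H \<in> altitude_line A i)"

text \<open>For \<open>d \<ge> 2\<close> the common point of the altitudes is unique; the definition is not meant
  for \<open>d = 1\<close>, where each altitude is the whole line.\<close>

definition orthocenter :: "(nat \<Rightarrow> 'a::euclidean_space) \<Rightarrow> 'a" where
  "orthocenter A = (THE H. \<forall>i\<in>{1..DIM('a) + 1}. H \<in> altitude_line A i)"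

definition rectangular :: "(nat \<Rightarrow> 'a::euclidean_space) \<Rightarrow> bool" where
  "rectangular A \<longleftrightarrow> orthocentric A \<and> (\<exists>i\<in>{1..DIM('a) + 1}. orthocenter A = A i)"

definition obtuseness :: "(nat \<Rightarrow> 'a::euclidean_space) \<Rightarrow> real" where
  "obtuseness A =
     (THE c. \<forall>i\<in>{1..DIM('a) + 1}. \<forall>j\<in>{1..DIM('a) + 1}. i \<noteq> j \<longrightarrow>
        (orthocenter A - A i) \<bullet> (orthocenter A - A j) = c)"

end

theory Submission
  imports Defs
begin

text \<open>
  Put \<open>e i = A i - H\<close>. Since \<open>H\<close> lies on the altitude through \<open>A i\<close>, the vector \<open>e i\<close> is orthogonal
  to \<open>A j - A k = e j - e k\<close> whenever \<open>j, k \<noteq> i\<close>; so \<open>e i \<bullet> e j\<close> depends neither on \<open>j\<close> nor, by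
  symmetry, on \<open>i\<close>, and equals the obtuseness \<open>c\<close>. Thus the Gram matrix of the \<open>e i\<close> is known
  except for its diagonal. The barycentric coordinates give the linear relation
  \<open>(\<Sum>i. a i *\<^sub>R e i) = 0\<close> with \<open>(\<Sum>i. a i) = 1\<close>, and pairing it with \<open>e j\<close> yields
  \<open>a j * (e j \<bullet> e j - c) = - c\<close>, which determines the diagonal.

  This relation also rules out degeneracies. If \<open>c = 0\<close>, then \<open>a j * (e j \<bullet> e j) = 0\<close> for all \<open>j\<close>;
  as no \<open>e j\<close> vanishes in a non-rectangular simplex, all \<open>a j\<close> would be \<open>0\<close>, though their sum is
  \<open>1\<close>. So \<open>c \<noteq> 0\<close>, whence \<open>a j \<noteq> 0\<close>, and then \<open>e j \<noteq> 0\<close> gives \<open>a j \<noteq> 1\<close>. All the norm formulas are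
  now evaluations of the quadratic form of the Gram matrix. The foot of the altitude from
  \<open>A i\<close> is found by eliminating \<open>A i\<close> from \<open>H = (\<Sum>j. a j *\<^sub>R A j)\<close>: the line through \<open>A i\<close> and \<open>H\<close>
  meets the hyperplane of the facet at the point whose barycentric coordinates in the facet are
  \<open>a j / (1 - a i)\<close>.
\<close>

section \<open>Vectors with constant mutual inner products\<close>

text \<open>The diagonal Gram entry is obtained by pairing the linear relation with \<open>e j\<close>.\<close>

lemma equal_inner_products_diagonal:
  fixes e :: "'i \<Rightarrow> 'v::real_inner"
  assumes "finite I" and "j \<in> I"
    and inner: "\<And>i j. i \<in> I \<Longrightarrow> j \<in> I \<Longrightarrow> i \<noteq> j \<Longrightarrow> e i \<bullet> e j = c"
    and relation: "(\<Sum>i\<in>I. a i *\<^sub>R e i) = 0" and "sum a I = 1"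
  shows "a j * (e j \<bullet> e j - c) = - c"
proof -
  have "0 = (\<Sum>i\<in>I. a i *\<^sub>R e i) \<bullet> e j"
    using relation by simp
  also have "\<dots> = (\<Sum>i\<in>I. a i * (e i \<bullet> e j))"
    by (simp add: inner_sum_left)
  also have "\<dots> = a j * (e j \<bullet> e j) + (\<Sum>i\<in>I - {j}. a i * c)"
    using assms by (subst sum.remove[of _ j]) auto
  also have "(\<Sum>i\<in>I - {j}. a i * c) = (1 - a j) * c"
    using assms by (simp add: sum_diff1 flip: sum_distrib_right)
  finally show ?thesis
    by (simp add: algebra_simps)
qed

text \<open>The Gram matrix is \<open>c\<close> times the all-ones matrix plus a diagonal matrix, so its quadratic
  form splits into a square and a sum of squares.\<close>

lemma equal_inner_products_norm_sum:
  fixes e :: "'i \<Rightarrow> 'v::real_inner"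
  assumes "finite I"
    and inner: "\<And>i j. i \<in> I \<Longrightarrow> j \<in> I \<Longrightarrow> i \<noteq> j \<Longrightarrow> e i \<bullet> e j = c"
  shows "(norm (\<Sum>i\<in>I. b i *\<^sub>R e i))\<^sup>2 = c * (sum b I)\<^sup>2 + (\<Sum>i\<in>I. (b i)\<^sup>2 * (e i \<bullet> e i - c))"
proof -
  have "(norm (\<Sum>i\<in>I. b i *\<^sub>R e i))\<^sup>2 = (\<Sum>i\<in>I. \<Sum>j\<in>I. b i * b j * (e i \<bullet> e j))"
    by (simp add: power2_norm_eq_inner inner_sum_left inner_sum_right sum_distrib_left inner_commute mult_ac)
  also have "\<dots> = (\<Sum>i\<in>I. \<Sum>j\<in>I. c * (b i * b j)
      + (if j = i then (b i)\<^sup>2 * (e i \<bullet> e i - c) else 0))"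
    by (intro sum.cong refl) (auto simp: inner algebra_simps power2_eq_square)
  also have "\<dots> = c * (sum b I)\<^sup>2 + (\<Sum>i\<in>I. (b i)\<^sup>2 * (e i \<bullet> e i - c))"
    using \<open>finite I\<close>
    by (simp add: sum.distrib power2_eq_square sum_product flip: sum_distrib_left)
  finally show ?thesis .
qed

text \<open>If \<open>c\<close> were \<open>0\<close>, the \<open>e i\<close> would be orthogonal and nonzero, hence independent, against the
  nontrivial relation. So \<open>c \<noteq> 0\<close>, and the diagonal formula excludes \<open>a j = 0\<close>; \<open>a j = 1\<close> would
  make it say \<open>e j \<bullet> e j = 0\<close>.\<close>

lemma equal_inner_products_nondegenerate:
  fixes e :: "'i \<Rightarrow> 'v::real_inner"
  assumes "finite I" and "j \<in> I"
    and inner: "\<And>i j. i \<in> I \<Longrightarrow> j \<in> I \<Longrightarrow> i \<noteq> j \<Longrightarrow> e i \<bullet> e j = c"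
    and relation: "(\<Sum>i\<in>I. a i *\<^sub>R e i) = 0" and sum1: "sum a I = 1"
    and nonzero: "\<And>i. i \<in> I \<Longrightarrow> e i \<noteq> 0"
  shows "a j \<noteq> 0" and "a j \<noteq> 1"
proof -
  have diagonal: "a i * (e i \<bullet> e i - c) = - c" if "i \<in> I" for i
    using equal_inner_products_diagonal[OF \<open>finite I\<close> that inner relation sum1] .
  have "c \<noteq> 0"
  proof
    assume "c = 0"
    then have "a i = 0" if "i \<in> I" for i
      using diagonal[OF that] nonzero[OF that] by simp
    with sum1 show False by simp
  qed
  then show "a j \<noteq> 0"
    using diagonal[OF \<open>j \<in> I\<close>] by auto
  show "a j \<noteq> 1"
    using diagonal[OF \<open>j \<in> I\<close>] nonzero[OF \<open>j \<in> I\<close>] by auto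
qed

section \<open>Orthocenter, obtuseness and feet of altitudes\<close>

lemma vertex_in_facet_hyperplane:
  fixes A :: "nat \<Rightarrow> 'a::euclidean_space"
  assumes "j \<in> {1..DIM('a) + 1}" and "j \<noteq> i"
  shows "A j \<in> facet_hyperplane A i"
  unfolding facet_hyperplane_def using assms by (intro hull_inc) auto

lemma altitude_line_orthogonal_edge:
  fixes A :: "nat \<Rightarrow> 'a::euclidean_space"
  assumes "P \<in> altitude_line A i"
    and "j \<in> {1..DIM('a) + 1}" "j \<noteq> i" and "k \<in> {1..DIM('a) + 1}" "k \<noteq> i"
  shows "(P - A i) \<bullet> (A j - A k) = 0"
  using assms vertex_in_facet_hyperplane[of j i A] vertex_in_facet_hyperplane[of k i A]
  unfolding altitude_line_def orthogonal_def by blast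

lemma simplex_affine_hull:
  fixes A :: "nat \<Rightarrow> 'a::euclidean_space"
  assumes "is_simplex A"
  shows "affine hull (A ` {1..DIM('a) + 1}) = UNIV"
  using assms unfolding is_simplex_def
  by (intro affine_independent_span_gt) (auto simp: card_image)

text \<open>The difference of two points on all altitudes is orthogonal to every edge \<open>A j - A k\<close>: in
  dimension at least two there is a third vertex \<open>A i\<close>, and the edge lies in the facet opposite
  to it. As the edges span the space, the difference is zero.\<close>

lemma common_point_of_altitudes_unique:
  fixes A :: "nat \<Rightarrow> 'a::euclidean_space"
  assumes dim: "DIM('a) \<ge> 2" and simplex: "is_simplex A"
    and P: "\<forall>i\<in>{1..DIM('a) + 1}. P \<in> altitude_line A i"
    and Q: "\<forall>i\<in>{1..DIM('a) + 1}. Q \<in> altitude_line A i"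
  shows "P = Q"
proof -
  have edge: "(P - Q) \<bullet> A j = (P - Q) \<bullet> A 1" if j: "j \<in> {1..DIM('a) + 1}" for j
  proof -
    obtain i where i: "i \<in> {1..DIM('a) + 1}" "i \<noteq> j" "i \<noteq> 1"
    proof (cases "j = 2")
      case True
      then show ?thesis using that[of 3] dim by auto
    next
      case False
      then show ?thesis using that[of 2] dim by auto
    qed
    have "(P - A i) \<bullet> (A j - A 1) = 0" "(Q - A i) \<bullet> (A j - A 1) = 0"
      using altitude_line_orthogonal_edge[of _ A i j 1] P Q i j by auto
    then show ?thesis
      by (simp add: algebra_simps)
  qed
  have "A ` {1..DIM('a) + 1} \<subseteq> {x. (P - Q) \<bullet> x = (P - Q) \<bullet> A 1}"
    using edge by blast
  then have "affine hull (A ` {1..DIM('a) + 1}) \<subseteq> {x. (P - Q) \<bullet> x = (P - Q) \<bullet> A 1}"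
    by (rule hull_minimal) (rule affine_hyperplane)
  then have "A 1 + (P - Q) \<in> {x. (P - Q) \<bullet> x = (P - Q) \<bullet> A 1}"
    using simplex_affine_hull[OF simplex] by blast
  then show ?thesis
    by (simp add: inner_add_right)
qed

lemma orthocenter_in_altitude_line:
  fixes A :: "nat \<Rightarrow> 'a::euclidean_space"
  assumes "DIM('a) \<ge> 2" and "orthocentric A" and "i \<in> {1..DIM('a) + 1}"
  shows "orthocenter A \<in> altitude_line A i"
proof -
  have simplex: "is_simplex A"
    and "\<exists>H. \<forall>i\<in>{1..DIM('a) + 1}. H \<in> altitude_line A i"
    using \<open>orthocentric A\<close> unfolding orthocentric_def by auto
  then have "\<exists>!H. \<forall>i\<in>{1..DIM('a) + 1}. H \<in> altitude_line A i"
    using common_point_of_altitudes_unique[OF \<open>DIM('a) \<ge> 2\<close> simplex] by blast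
  from theI'[OF this] show ?thesis
    using \<open>i \<in> _\<close> unfolding orthocenter_def by blast
qed

text \<open>Orthogonality to the facets lets each of the two indices of the inner product be replaced
  in turn, so all pairs of distinct indices give the same value.\<close>

lemma inner_vertices_eq_obtuseness:
  fixes A :: "nat \<Rightarrow> 'a::euclidean_space"
  assumes dim: "DIM('a) \<ge> 2" and orthocentric: "orthocentric A"
    and ij: "i \<in> {1..DIM('a) + 1}" "j \<in> {1..DIM('a) + 1}" "i \<noteq> j"
  shows "(A i - orthocenter A) \<bullet> (A j - orthocenter A) = obtuseness A"
proof -
  define H where "H = orthocenter A"
  define g where "g i j = (H - A i) \<bullet> (H - A j)" for i j
  have sym: "g i j = g j i" for i j
    unfolding g_def by (rule inner_commute)
  have swap: "g i j = g i k"
    if "i \<in> {1..DIM('a) + 1}" "j \<in> {1..DIM('a) + 1}" "k \<in> {1..DIM('a) + 1}" "j \<noteq> i" "k \<noteq> i"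
    for i j k
  proof -
    have "(H - A i) \<bullet> (A j - A k) = 0"
      using altitude_line_orthogonal_edge orthocenter_in_altitude_line[OF dim orthocentric] that
      unfolding H_def by blast
    then show ?thesis
      unfolding g_def by (simp add: inner_diff_right)
  qed
  have const: "g k l = g i j"
    if "k \<in> {1..DIM('a) + 1}" "l \<in> {1..DIM('a) + 1}" "k \<noteq> l" for k l
  proof (cases "k = i")
    case True
    then show ?thesis using swap that ij by metis
  next
    case False
    then show ?thesis using swap sym that ij by metis
  qed
  have "obtuseness A = g i j"
    unfolding obtuseness_def
  proof (rule the_equality)
    show "\<forall>k\<in>{1..DIM('a) + 1}. \<forall>l\<in>{1..DIM('a) + 1}. k \<noteq> l \<longrightarrow>
        (orthocenter A - A k) \<bullet> (orthocenter A - A l) = g i j"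
      using const unfolding g_def H_def by blast
    show "c = g i j"
      if "\<forall>k\<in>{1..DIM('a) + 1}. \<forall>l\<in>{1..DIM('a) + 1}. k \<noteq> l \<longrightarrow>
        (orthocenter A - A k) \<bullet> (orthocenter A - A l) = c" for c
      using that ij unfolding g_def H_def by blast
  qed
  then show ?thesis
    unfolding g_def H_def by (metis inner_minus_left inner_minus_right minus_diff_eq minus_minus)
qed

text \<open>If two points of the facet hyperplane lie on the altitude, their difference is orthogonal
  to itself.\<close>

lemma altitude_foot_eqI:
  fixes A :: "nat \<Rightarrow> 'a::euclidean_space"
  assumes B: "B \<in> facet_hyperplane A i" "B \<in> altitude_line A i"
  shows "altitude_foot A i = B"
  unfolding altitude_foot_def
proof (rule the_equality)
  fix C assume C: "C \<in> facet_hyperplane A i \<and> C \<in> altitude_line A i"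
  have "(B - A i) \<bullet> (B - C) = 0" "(C - A i) \<bullet> (B - C) = 0"
    using B C unfolding altitude_line_def orthogonal_def by blast+
  then have "(B - C) \<bullet> (B - C) = 0"
    by (simp add: inner_diff_left)
  then show "C = B" by simp
qed (use B in simp)

lemma altitude_line_affine_combination:
  assumes "P \<in> altitude_line A i"
  shows "P + t *\<^sub>R (A i - P) \<in> altitude_line A i"
proof -
  have "P + t *\<^sub>R (A i - P) - A i = (1 - t) *\<^sub>R (P - A i)"
    by (simp add: algebra_simps)
  with assms show ?thesis
    unfolding altitude_line_def by (simp add: orthogonal_clauses)
qed

text \<open>The family \<open>x\<close> may have repetitions, so its coefficients are indexed by \<open>J\<close>. Subtracting a
  point of \<open>V\<close> turns the claim into closure of a subspace under linear combinations.\<close>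

lemma affine_indexed_combination:
  fixes x :: "'i \<Rightarrow> 'v::real_vector"
  assumes "affine V" and "finite J" and x: "\<And>j. j \<in> J \<Longrightarrow> x j \<in> V" and u: "sum u J = 1"
  shows "(\<Sum>j\<in>J. u j *\<^sub>R x j) \<in> V"
proof -
  obtain k where k: "k \<in> J"
    using u by fastforce
  have "subspace ((\<lambda>y. y - x k) ` V)"
    using affine_diffs_subspace_subtract[OF \<open>affine V\<close> x[OF k]] .
  then have "(\<Sum>j\<in>J. u j *\<^sub>R (x j - x k)) \<in> (\<lambda>y. y - x k) ` V"
    using x by (intro subspace_sum subspace_scale) (auto simp: image_iff)
  moreover have "(\<Sum>j\<in>J. u j *\<^sub>R (x j - x k)) = (\<Sum>j\<in>J. u j *\<^sub>R x j) - x k"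
    using u by (simp add: scaleR_diff_right sum_subtractf flip: scaleR_sum_left)
  ultimately show ?thesis by auto
qed

text \<open>Removing the term \<open>a i *\<^sub>R A i\<close> from the barycentric expansion of \<open>P\<close> and rescaling the
  remaining weights to sum \<open>1\<close> gives the point \<open>(1 / (1 - a i)) *\<^sub>R (P - a i *\<^sub>R A i)\<close> of the facet
  hyperplane; the form \<open>P + t *\<^sub>R (A i - P)\<close> shows that it also stays on any altitude through
  \<open>A i\<close> that contains \<open>P\<close>.\<close>

lemma projection_from_vertex_in_facet_hyperplane:
  fixes A :: "nat \<Rightarrow> 'a::euclidean_space"
  assumes i: "i \<in> {1..DIM('a) + 1}"
    and P: "P = (\<Sum>j=1..DIM('a) + 1. a j *\<^sub>R A j)" and sum1: "(\<Sum>j=1..DIM('a) + 1. a j) = 1"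
    and "a i \<noteq> 1"
  shows "P + (a i / (a i - 1)) *\<^sub>R (A i - P) \<in> facet_hyperplane A i"
proof -
  let ?J = "{1..DIM('a) + 1} - {i}"
  have "P + (a i / (a i - 1)) *\<^sub>R (A i - P) = (1 / (1 - a i)) *\<^sub>R (P - a i *\<^sub>R A i)"
  proof -
    have "a i / (a i - 1) = - (a i / (1 - a i))" and "1 + a i / (1 - a i) = 1 / (1 - a i)"
      using \<open>a i \<noteq> 1\<close> by (auto simp: field_simps)
    then show ?thesis
      by (simp add: algebra_simps flip: scaleR_add_left) (metis scaleR_add_left scaleR_one)
  qed
  also have "P - a i *\<^sub>R A i = (\<Sum>j\<in>?J. a j *\<^sub>R A j)"
    using i by (simp add: P sum_diff1)
  also have "(1 / (1 - a i)) *\<^sub>R \<dots> = (\<Sum>j\<in>?J. (a j / (1 - a i)) *\<^sub>R A j)"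
    by (simp add: scaleR_sum_right)
  also have "\<dots> \<in> facet_hyperplane A i"
  proof (rule affine_indexed_combination)
    show "affine (facet_hyperplane A i)"
      unfolding facet_hyperplane_def by simp
    have "(\<Sum>j\<in>?J. a j) = 1 - a i"
      using i sum1 by (simp add: sum_diff1)
    then show "(\<Sum>j\<in>?J. a j / (1 - a i)) = 1"
      using \<open>a i \<noteq> 1\<close> by (simp flip: sum_divide_distrib)
    show "A j \<in> facet_hyperplane A i" if "j \<in> ?J" for j
      using that by (intro vertex_in_facet_hyperplane) auto
  qed simp
  finally show ?thesis .
qed

section \<open>Metric formulas in barycentric coordinates of the orthocenter\<close>

theorem theorem3p3:
  fixes A :: "nat \<Rightarrow> 'a::euclidean_space" and a :: "nat \<Rightarrow> real" and H :: 'a and c :: real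
  assumes dim: "DIM('a) \<ge> 2"
    and orthocentric: "orthocentric A"
    and non_rectangular: "\<not> rectangular A"
    and H: "H = orthocenter A"
    and barycentric: "H = (\<Sum>i=1..DIM('a) + 1. a i *\<^sub>R A i)" "(\<Sum>i=1..DIM('a) + 1. a i) = 1"
    and c: "c = obtuseness A"
  shows "(\<forall>i\<in>{1..DIM('a) + 1}. a i \<noteq> 0 \<and> a i \<noteq> 1)
    \<and> (\<forall>b :: nat \<Rightarrow> real.
          (norm (\<Sum>i=1..DIM('a) + 1. b i *\<^sub>R (A i - H)))\<^sup>2
            = c * ((\<Sum>i=1..DIM('a) + 1. b i)\<^sup>2 - (\<Sum>i=1..DIM('a) + 1. (b i)\<^sup>2 / a i)))
    \<and> (\<forall>i\<in>{1..DIM('a) + 1}. (norm (A i - H))\<^sup>2 = c * (a i - 1) / a i)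
    \<and> (\<forall>i\<in>{1..DIM('a) + 1}. \<forall>j\<in>{1..DIM('a) + 1}. j \<noteq> i \<longrightarrow>
          (norm (A i - A j))\<^sup>2 = - c * (1 / a i + 1 / a j))
    \<and> (\<forall>i\<in>{1..DIM('a) + 1}.
          altitude_foot A i - H = (a i / (a i - 1)) *\<^sub>R (A i - H)
          \<and> (norm (A i - altitude_foot A i))\<^sup>2 = c / (a i * (a i - 1)))"
proof -
  let ?I = "{1..DIM('a) + 1}"
  define e where "e i = A i - H" for i
  have inner: "e i \<bullet> e j = c" if "i \<in> ?I" "j \<in> ?I" "i \<noteq> j" for i j
    using inner_vertices_eq_obtuseness[OF dim orthocentric that] by (simp add: e_def H c)
  have nonzero: "e i \<noteq> 0" if "i \<in> ?I" for i
    using non_rectangular orthocentric that unfolding rectangular_def e_def H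
    by (metis right_minus_eq)
  have relation: "(\<Sum>i\<in>?I. a i *\<^sub>R e i) = 0"
  proof -
    have "(\<Sum>i\<in>?I. a i *\<^sub>R e i) = (\<Sum>i\<in>?I. a i *\<^sub>R A i) - (\<Sum>i\<in>?I. a i) *\<^sub>R H"
      unfolding e_def by (simp only: scaleR_diff_right sum_subtractf scaleR_sum_left)
    then show ?thesis
      unfolding barycentric(2) using barycentric(1) by simp
  qed
  have coords: "a i \<noteq> 0" "a i \<noteq> 1" if "i \<in> ?I" for i
    using equal_inner_products_nondegenerate
      [OF finite_atLeastAtMost that inner relation barycentric(2) nonzero] by auto
  have diagonal: "e i \<bullet> e i - c = - c / a i" if "i \<in> ?I" for i
    using equal_inner_products_diagonal
      [OF finite_atLeastAtMost that inner relation barycentric(2)] coords(1)[OF that]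
    by (simp add: field_simps)
  have norm_e: "(norm (e i))\<^sup>2 = c * (a i - 1) / a i" if "i \<in> ?I" for i
    using diagonal[OF that] coords(1)[OF that]
    by (simp add: power2_norm_eq_inner field_simps)
  have form: "(norm (\<Sum>i\<in>?I. b i *\<^sub>R e i))\<^sup>2
      = c * ((\<Sum>i\<in>?I. b i)\<^sup>2 - (\<Sum>i\<in>?I. (b i)\<^sup>2 / a i))" for b
  proof -
    have "(norm (\<Sum>i\<in>?I. b i *\<^sub>R e i))\<^sup>2
        = c * (\<Sum>i\<in>?I. b i)\<^sup>2 + (\<Sum>i\<in>?I. (b i)\<^sup>2 * (e i \<bullet> e i - c))"
      using inner by (intro equal_inner_products_norm_sum) auto
    also have "(\<Sum>i\<in>?I. (b i)\<^sup>2 * (e i \<bullet> e i - c)) = (\<Sum>i\<in>?I. - (c * ((b i)\<^sup>2 / a i)))"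
      by (intro sum.cong refl) (simp add: diagonal)
    also have "\<dots> = - (c * (\<Sum>i\<in>?I. (b i)\<^sup>2 / a i))"
      by (simp only: sum_negf sum_distrib_left)
    finally show ?thesis
      by (simp add: right_diff_distrib)
  qed
  have edge: "(norm (A i - A j))\<^sup>2 = - c * (1 / a i + 1 / a j)"
    if ij: "i \<in> ?I" "j \<in> ?I" "j \<noteq> i" for i j
  proof -
    have "A i - A j = e i - e j"
      by (simp add: e_def)
    then have "(norm (A i - A j))\<^sup>2 = (e i \<bullet> e i - c) + (e j \<bullet> e j - c)"
      using inner[of i j] ij
      by (simp add: power2_norm_eq_inner inner_diff_left inner_diff_right inner_commute)
    then show ?thesis
      unfolding diagonal[OF ij(1)] diagonal[OF ij(2)] by (simp add: algebra_simps)
  qed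
  have foot: "altitude_foot A i - H = (a i / (a i - 1)) *\<^sub>R e i" if i: "i \<in> ?I" for i
  proof -
    have "H \<in> altitude_line A i"
      using orthocenter_in_altitude_line[OF dim orthocentric i] by (simp add: H)
    then have "altitude_foot A i = H + (a i / (a i - 1)) *\<^sub>R (A i - H)"
      by (intro altitude_foot_eqI altitude_line_affine_combination
          projection_from_vertex_in_facet_hyperplane i barycentric coords(2))
    then show ?thesis
      by (simp add: e_def)
  qed
  have height: "(norm (A i - altitude_foot A i))\<^sup>2 = c / (a i * (a i - 1))" if i: "i \<in> ?I" for i
  proof -
    have "A i - altitude_foot A i = e i - (altitude_foot A i - H)"
      by (simp add: e_def)
    also have "\<dots> = (1 - a i / (a i - 1)) *\<^sub>R e i"
      unfolding foot[OF i] by (simp add: scaleR_diff_left)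
    finally have "(norm (A i - altitude_foot A i))\<^sup>2
        = (1 - a i / (a i - 1))\<^sup>2 * (c * (a i - 1) / a i)"
      by (simp add: power_mult_distrib norm_e[OF i])
    also have "1 - a i / (a i - 1) = - 1 / (a i - 1)"
      using coords(2)[OF i] by (simp add: field_simps)
    also have "(- 1 / (a i - 1))\<^sup>2 * (c * (a i - 1) / a i) = c / (a i * (a i - 1))"
      using coords[OF i] by (simp add: power2_eq_square divide_simps)
    finally show ?thesis .
  qed
  show ?thesis
    using coords form norm_e edge foot height unfolding e_def by blast
qed

end
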